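(* Let $N\ge1$ be odd, let $\omega\in\mathbb{C}$ with $|\omega|=1$, and let $a_0,\dots,a_{N-1}\in\mathbb{C}$ with $|a_n|<1$ for all $n$. Let $\mathcal{U}=\mathcal{M}_2\mathcal{M}_1$ be the unitary CMV matrix of size $N+1$ built from $(a_n)_{n=0}^{N-1}$ and $\omega$, and let $\hat{\mathcal{U}}=\hat{\mathcal{M}}_2\hat{\mathcal{M}}_1$ be the CMV matrix built in the same way from $\hat a_n=-\omega\,\overline{a_{N-n-1}}$, $n=0,\dots,N-1$, and the same $\omega$. Then $$\hat{\mathcal{U}}=Q_N(\tau)\,\mathcal{U}\,Q_N(\tau),\qquad\text{where }\tau=\omega^{-1/2}$$ (any fixed square root).
   Context: Put $\rho_k=\sqrt{1-|a_k|^2}$ and $\Theta_k=\begin{pmatrix}\overline{a_k}&\rho_k\\ \rho_k&-a_k\end{pmatrix}$. For odd $N$ the CMV factors are the block-diagonal $(N+1)\times(N+1)$ matrices $$\mathcal{M}_1=(1)\oplus\Theta_1\oplus\Theta_3\oplus\dots\oplus\Theta_{N-2}\oplus(\omega^{-1}),\qquad \mathcal{M}_2=\Theta_0\oplus\Theta_2\oplus\dots\oplus\Theta_{N-1}.$$ For $|\tau|=1$, the quasi-reflection matrix $Q_N(\tau)$ is the $(N+1)\times(N+1)$ matrix (rows and columns indexed by $0,\dots,N$) whose only nonzero entries are on the main antidiagonal, with entry $\tau^{(-1)^k}$ in position $(k,N-k)$, i.e. alternating $\tau,\tau^{-1},\tau,\dots$ starting with $\tau$ in the top right corner. *)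

theory Defs
  imports Complex_Main "Jordan_Normal_Form.Matrix"
begin

definition cmv_rho :: "complex \<Rightarrow> real" where
  "cmv_rho \<alpha> = sqrt (1 - (cmod \<alpha>)\<^sup>2)"

definition cmv_Theta :: "complex \<Rightarrow> complex mat" where
  "cmv_Theta \<alpha> = mat_of_rows_list 2
     [[cnj \<alpha>, complex_of_real (cmv_rho \<alpha>)],
      [complex_of_real (cmv_rho \<alpha>), - \<alpha>]]"

text \<open>The three definitions below are meant for odd \<open>N\<close>; only \<open>a 0, \<dots>, a (N - 1)\<close> matter.
  The odd indices \<open>1, 3, \<dots>, N - 2\<close> are \<open>2 * j + 1\<close> with \<open>j < (N - 1) div 2\<close> (none if \<open>N = 1\<close>),
  the even indices \<open>0, 2, \<dots>, N - 1\<close> are \<open>2 * j\<close> with \<open>j < (N + 1) div 2\<close>.\<close>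

definition cmv_M1 :: "nat \<Rightarrow> (nat \<Rightarrow> complex) \<Rightarrow> complex \<Rightarrow> complex mat" where
  "cmv_M1 N a \<omega> = diag_block_mat
     ([mat_of_rows_list 1 [[1]]]
      @ map (\<lambda>j. cmv_Theta (a (2 * j + 1))) [0..<(N - 1) div 2]
      @ [mat_of_rows_list 1 [[inverse \<omega>]]])"

definition cmv_M2 :: "nat \<Rightarrow> (nat \<Rightarrow> complex) \<Rightarrow> complex mat" where
  "cmv_M2 N a = diag_block_mat (map (\<lambda>j. cmv_Theta (a (2 * j))) [0..<(N + 1) div 2])"

definition cmv_matrix :: "nat \<Rightarrow> (nat \<Rightarrow> complex) \<Rightarrow> complex \<Rightarrow> complex mat" where
  "cmv_matrix N a \<omega> = cmv_M2 N a * cmv_M1 N a \<omega>"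

definition quasi_reflection :: "nat \<Rightarrow> complex \<Rightarrow> complex mat" where
  "quasi_reflection N \<tau> =
     mat (N + 1) (N + 1) (\<lambda>(k, l). if l = N - k then \<tau> powi ((-1 :: int) ^ k) else 0)"

end

theory Submission
  imports Defs
begin

text \<open>
  Conjugation by \<open>Q(\<tau>)\<close> does not carry \<open>\<M>\<^sub>1\<close> to its reflected counterpart (the corner
  entries \<open>1\<close> and \<open>\<omega>\<^sup>-\<^sup>1\<close> get swapped); the remedy is to use \<open>Q(\<tau>\<^sup>-\<^sup>1)\<close> on
  one side. Comparing entries gives \<open>Q(\<tau>) \<M>\<^sub>2 Q(\<tau>\<^sup>-\<^sup>1)\<close> and
  \<open>Q(\<tau>\<^sup>-\<^sup>1) \<M>\<^sub>1 Q(\<tau>)\<close> for the two reflected factors, and the inner factors cancel since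
  \<open>Q(\<sigma>)\<close> squares to the identity when \<open>N\<close> is odd.
\<close>

section \<open>Entries of the two block-diagonal factors\<close>

lemma cmv_Theta_carrier [simp]: "cmv_Theta z \<in> carrier_mat 2 2"
  by (rule carrier_matI) (simp_all add: cmv_Theta_def mat_of_rows_list_def)

lemma index_cmv_Theta:
  assumes "i < 2" "j < 2"
  shows "cmv_Theta z $$ (i, j) =
    (if i = j then if i = 0 then cnj z else - z else complex_of_real (cmv_rho z))"
  using assms by (auto simp: cmv_Theta_def mat_of_rows_list_def less_2_cases_iff)

lemma diag_block_mat_Theta_carrier:
  "diag_block_mat (map (\<lambda>j. cmv_Theta (f j)) [0..<n]) \<in> carrier_mat (2 * n) (2 * n)"
  by (rule carrier_matI) (simp_all add: dim_diag_block_mat o_def cmv_Theta_carrier[THEN carrier_matD(1)]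
      cmv_Theta_carrier[THEN carrier_matD(2)] sum_list_triv)

text \<open>The quotient by 2 names the block containing an index and the parity names the place
  inside the block, so entries can be compared without unfolding the recursion of
  \<open>diag_block_mat\<close>.\<close>

lemma index_diag_block_mat_Theta:
  assumes "i < 2 * n" "j < 2 * n"
  shows "diag_block_mat (map (\<lambda>j. cmv_Theta (f j)) [0..<n]) $$ (i, j) =
    (if i = j then if even i then cnj (f (i div 2)) else - f (i div 2)
     else if i div 2 = j div 2 then complex_of_real (cmv_rho (f (i div 2))) else 0)"
  using assms
\<comment> \<open>Peeling off the head block leaves the blocks of the shifted sequence
  \<open>f (Suc j)\<close>, hence the generalisation over \<open>f\<close>.\<close>
proof (induction n arbitrary: f i j)
  case (Suc n)
  let ?B = "diag_block_mat (map (\<lambda>j. cmv_Theta (f (Suc j))) [0..<n])"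
  have B: "?B \<in> carrier_mat (2 * n) (2 * n)"
    by (rule diag_block_mat_Theta_carrier)
  have split: "map (\<lambda>j. cmv_Theta (f j)) [0..<Suc n] =
      cmv_Theta (f 0) # map (\<lambda>j. cmv_Theta (f (Suc j))) [0..<n]"
    by (simp add: upt_conv_Cons map_Suc_upt[symmetric] o_def del: upt_Suc)
  have eq: "diag_block_mat (map (\<lambda>j. cmv_Theta (f j)) [0..<Suc n]) $$ (i, j) =
      (if i < 2 then if j < 2 then cmv_Theta (f 0) $$ (i, j) else 0
       else if j < 2 then 0 else ?B $$ (i - 2, j - 2))"
    using Suc.prems B unfolding split
    by (auto simp: Let_def cmv_Theta_carrier[THEN carrier_matD(1)]
        cmv_Theta_carrier[THEN carrier_matD(2)])
  show ?case
  proof (cases "i < 2 \<or> j < 2")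
    case True
    have "i div 2 = 0 \<longleftrightarrow> i < 2" "j div 2 = 0 \<longleftrightarrow> j < 2" by auto
    moreover have "i < 2 \<Longrightarrow> even i \<longleftrightarrow> i = 0" "j < 2 \<Longrightarrow> even j \<longleftrightarrow> j = 0"
      by presburger+
    ultimately show ?thesis
      unfolding eq using True by (cases "i < 2"; cases "j < 2") (simp_all add: index_cmv_Theta)
  next
    case False
    \<comment> \<open>Past the first block both indices drop by 2: parity is kept and the block
      number drops by 1, matching the shift in \<open>f\<close>.\<close>
    define i' j' where "i' = i - 2" and "j' = j - 2"
    have ij: "i = Suc (Suc i')" "j = Suc (Suc j')"
      using False by (auto simp: i'_def j'_def)
    have "i' < 2 * n" "j' < 2 * n"
      using Suc.prems by (auto simp: ij)
    from Suc.IH[OF this, of "\<lambda>j. f (Suc j)"]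
    have "?B $$ (i - 2, j - 2) =
      (if i' = j' then if even i' then cnj (f (Suc (i' div 2))) else - f (Suc (i' div 2))
       else if i' div 2 = j' div 2 then complex_of_real (cmv_rho (f (Suc (i' div 2)))) else 0)"
      by (simp only: i'_def j'_def)
    moreover have "i div 2 = Suc (i' div 2)" "j div 2 = Suc (j' div 2)"
      "even i \<longleftrightarrow> even i'" "i = j \<longleftrightarrow> i' = j'"
      by (auto simp: ij)
    ultimately show ?thesis
      unfolding eq using False by (simp only: de_Morgan_disj if_False nat.inject)
  qed
qed simp

lemma cmv_M2_carrier:
  assumes "odd N"
  shows "cmv_M2 N a \<in> carrier_mat (N + 1) (N + 1)"
  using diag_block_mat_Theta_carrier[of "\<lambda>j. a (2 * j)" "(N + 1) div 2"] assms
  by (simp add: cmv_M2_def)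

text \<open>Row \<open>i\<close> lies in the block of coefficient \<open>2 * (i div 2)\<close>,
  which is \<open>i\<close> for even \<open>i\<close> and \<open>i - 1\<close> for odd
  \<open>i\<close>.\<close>

lemma index_cmv_M2:
  assumes "odd N" "i \<le> N" "j \<le> N"
  shows "cmv_M2 N a $$ (i, j) =
    (if i = j then if even i then cnj (a i) else - a (i - 1)
     else if i div 2 = j div 2 then complex_of_real (cmv_rho (a (2 * (i div 2)))) else 0)"
  using index_diag_block_mat_Theta[of i "(N + 1) div 2" j "\<lambda>j. a (2 * j)"] assms
  by (auto simp: cmv_M2_def elim!: oddE)

lemma diag_block_mat_corners_carrier:
  assumes "diag_block_mat As \<in> carrier_mat n n"
  shows "diag_block_mat ([mat_of_rows_list 1 [[x]]] @ As @ [mat_of_rows_list 1 [[y]]])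
    \<in> carrier_mat (n + 2) (n + 2)"
  using carrier_matD[OF assms]
  by (intro carrier_matI) (simp_all add: dim_diag_block_mat mat_of_rows_list_def)

lemma index_diag_block_mat_corners:
  assumes As: "diag_block_mat As \<in> carrier_mat n n" and "i < n + 2" "j < n + 2"
  shows "diag_block_mat ([mat_of_rows_list 1 [[x]]] @ As @ [mat_of_rows_list 1 [[y]]]) $$ (i, j) =
    (if i \<in> {1..n} \<and> j \<in> {1..n} then diag_block_mat As $$ (i - 1, j - 1)
     else if i = j then if i = 0 then x else y else 0)"
  using assms by (auto simp: diag_block_mat_last Let_def mat_of_rows_list_def)

lemma cmv_M1_carrier:
  assumes "odd N"
  shows "cmv_M1 N a \<omega> \<in> carrier_mat (N + 1) (N + 1)"
  using diag_block_mat_corners_carrier[OF diag_block_mat_Theta_carrier[of "\<lambda>j. a (2 * j + 1)" "(N - 1) div 2"]]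
    assms
  by (auto simp: cmv_M1_def elim!: oddE)

text \<open>The leading 1 x 1 block shifts everything by one: the block of
  \<open>a (2 * j + 1)\<close> occupies rows \<open>2 * j + 1\<close> and \<open>2 * j + 2\<close>,
  so blocks are numbered by \<open>(i + 1) div 2\<close>. The corners 0 and \<open>N\<close> are
  alone in their classes.\<close>

lemma index_cmv_M1:
  assumes "odd N" "i \<le> N" "j \<le> N"
  shows "cmv_M1 N a \<omega> $$ (i, j) =
    (if i = j then if i = 0 then 1 else if i = N then inverse \<omega>
       else if odd i then cnj (a i) else - a (i - 1)
     else if (i + 1) div 2 = (j + 1) div 2
       then complex_of_real (cmv_rho (a (2 * ((i + 1) div 2) - 1))) else 0)"
proof -
  obtain m where N: "N = 2 * m + 1" using assms by (auto elim: oddE)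
  have eq: "cmv_M1 N a \<omega> $$ (i, j) =
    (if i \<in> {1..2 * m} \<and> j \<in> {1..2 * m}
      then diag_block_mat (map (\<lambda>j. cmv_Theta (a (2 * j + 1))) [0..<m]) $$ (i - 1, j - 1)
     else if i = j then if i = 0 then 1 else inverse \<omega> else 0)"
    unfolding cmv_M1_def N
    using index_diag_block_mat_corners[OF diag_block_mat_Theta_carrier[of "\<lambda>j. a (2 * j + 1)" m]]
      assms by (simp add: N)
  \<comment> \<open>After the shift by one the right corner has index \<open>2 * m\<close>, which is
    even; its partner would be \<open>2 * m + 1\<close>, out of range.\<close>
  have *: "x < 2 * m" if "x div 2 = y div 2" "odd y" "y \<le> 2 * m" for x y :: nat
    using that by presburger
  show ?thesis
    using eq assms index_diag_block_mat_Theta[of "i - 1" m "j - 1" "\<lambda>j. a (2 * j + 1)"]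
    by (cases i; cases j) (auto simp: N dest: *)
qed

section \<open>Multiplication by quasi-reflections\<close>

lemma quasi_reflection_carrier [simp]: "quasi_reflection N \<tau> \<in> carrier_mat (N + 1) (N + 1)"
  by (simp add: quasi_reflection_def)

lemma index_quasi_reflection_mult:
  assumes M: "M \<in> carrier_mat (N + 1) (N + 1)" and "k \<le> N" "l \<le> N"
  shows "(quasi_reflection N \<sigma> * M) $$ (k, l) = \<sigma> powi ((-1) ^ k) * M $$ (N - k, l)"
proof -
  have "(quasi_reflection N \<sigma> * M) $$ (k, l) =
      (\<Sum>i = 0..<N + 1. (if i = N - k then \<sigma> powi ((-1) ^ k) else 0) * M $$ (i, l))"
    using assms by (simp add: quasi_reflection_def scalar_prod_def)
  also have "\<dots> = (\<Sum>i = 0..<N + 1. if i = N - k then \<sigma> powi ((-1) ^ k) * M $$ (N - k, l) else 0)"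
    by (rule sum.cong) auto
  finally show ?thesis by simp
qed

text \<open>Column \<open>l\<close> of the quasi-reflection is nonzero only in row
  \<open>N - l\<close>, and the weight is indexed by that row.\<close>

lemma index_mult_quasi_reflection:
  assumes M: "M \<in> carrier_mat (N + 1) (N + 1)" and "k \<le> N" "l \<le> N"
  shows "(M * quasi_reflection N \<sigma>) $$ (k, l) = M $$ (k, N - l) * \<sigma> powi ((-1) ^ (N - l))"
proof -
  have "(M * quasi_reflection N \<sigma>) $$ (k, l) =
      (\<Sum>i = 0..<N + 1. M $$ (k, i) * (if l = N - i then \<sigma> powi ((-1) ^ i) else 0))"
    using assms by (simp add: quasi_reflection_def scalar_prod_def)
  also have "\<dots> = (\<Sum>i = 0..<N + 1. if i = N - l then M $$ (k, N - l) * \<sigma> powi ((-1) ^ (N - l)) else 0)"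
    using assms by (intro sum.cong) auto
  finally show ?thesis by simp
qed

text \<open>For odd \<open>N\<close>, rows \<open>k\<close> and \<open>N - k\<close> have opposite
  parity, so their weights are mutually inverse.\<close>

lemma quasi_reflection_square:
  assumes "odd N" "\<sigma> \<noteq> 0"
  shows "quasi_reflection N \<sigma> * quasi_reflection N \<sigma> = 1\<^sub>m (N + 1)"
proof (rule eq_matI)
  fix k l assume "k < dim_row (1\<^sub>m (N + 1))" "l < dim_col (1\<^sub>m (N + 1))"
  then have kl: "k \<le> N" "l \<le> N" by auto
  show "(quasi_reflection N \<sigma> * quasi_reflection N \<sigma>) $$ (k, l) = 1\<^sub>m (N + 1) $$ (k, l)"
    unfolding index_quasi_reflection_mult[OF quasi_reflection_carrier kl]
    using assms kl by (cases "even k") (auto simp: quasi_reflection_def power_int_minus)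
qed (auto simp: quasi_reflection_def)

text \<open>The column weight has exponent sign \<open>(-1) ^ (N - l)\<close>. Odd \<open>N\<close>
  flips this sign and inverting \<sigma> flips it back, so rows and columns follow the same parity
  rule.\<close>

lemma index_quasi_reflection_conj:
  assumes "odd N" "M \<in> carrier_mat (N + 1) (N + 1)" "k \<le> N" "l \<le> N"
  shows "(quasi_reflection N \<sigma> * M * quasi_reflection N (inverse \<sigma>)) $$ (k, l) =
    (if even k then \<sigma> else inverse \<sigma>) * (if even l then \<sigma> else inverse \<sigma>) * M $$ (N - k, N - l)"
proof -
  have "quasi_reflection N \<sigma> * M \<in> carrier_mat (N + 1) (N + 1)"
    by (rule mult_carrier_mat[OF quasi_reflection_carrier assms(2)])
  with assms show ?thesis
    by (auto simp: index_mult_quasi_reflection index_quasi_reflection_mult power_int_minus)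
qed

section \<open>Reflection of coefficients, index pairs and the two factors\<close>

lemma cmv_rho_reflect:
  assumes "cmod \<omega> = 1"
  shows "cmv_rho (- (\<omega> * cnj z)) = cmv_rho z"
  using assms by (simp add: cmv_rho_def norm_mult)

text \<open>With \<open>N = 2 * m + 1\<close>, the map \<open>i\<close> to \<open>N - i\<close>
  sends the pair \<open>{2 * j, 2 * j + 1}\<close> to pair number \<open>m - j\<close>. The second
  claim locates the coefficient that the reflected sequence uses in the block of
  \<open>k\<close>.\<close>

lemma odd_diff_div_2:
  fixes N k l :: nat
  assumes "odd N" "k \<le> N" "l \<le> N"
  shows odd_diff_div_2_eq_iff: "(N - k) div 2 = (N - l) div 2 \<longleftrightarrow> k div 2 = l div 2"
    and odd_diff_double_div_2: "N - 2 * (k div 2) - 1 = 2 * ((N - k) div 2)"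
proof -
  obtain m where N: "N = 2 * m + 1" using assms by (auto elim: oddE)
  have *: "(N - i) div 2 = m - i div 2" if "i \<le> N" for i
    using that by (cases "even i") (auto simp: N elim!: evenE oddE)
  show "(N - k) div 2 = (N - l) div 2 \<longleftrightarrow> k div 2 = l div 2"
    using assms * unfolding N by auto
  show "N - 2 * (k div 2) - 1 = 2 * ((N - k) div 2)" using * assms by (auto simp: N)
qed

text \<open>The analogue for the pairs \<open>{2 * j - 1, 2 * j}\<close> of \<M>1. Corners carry no
  coefficient, and at \<open>k = 0\<close> truncated subtraction would make the second claim
  false.\<close>

lemma odd_diff_Suc_div_2:
  fixes N k l :: nat
  assumes "odd N" "k \<le> N" "l \<le> N"
  shows odd_diff_Suc_div_2_eq_iff:
      "(N - k + 1) div 2 = (N - l + 1) div 2 \<longleftrightarrow> (k + 1) div 2 = (l + 1) div 2"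
    and odd_diff_double_Suc_div_2: "0 < k \<Longrightarrow> k < N \<Longrightarrow>
      N - (2 * ((k + 1) div 2) - 1) - 1 = 2 * ((N - k + 1) div 2) - 1"
proof -
  obtain m where N: "N = 2 * m + 1" using assms by (auto elim: oddE)
  have *: "(N - i + 1) div 2 = m + 1 - (i + 1) div 2" if "i \<le> N" for i
    using that by (cases "even i") (auto simp: N elim!: evenE oddE)
  show "(N - k + 1) div 2 = (N - l + 1) div 2 \<longleftrightarrow> (k + 1) div 2 = (l + 1) div 2"
    using assms * unfolding N by auto
  show "N - (2 * ((k + 1) div 2) - 1) - 1 = 2 * ((N - k + 1) div 2) - 1" if "0 < k" "k < N"
    using * assms that by (auto simp: N)
qed

text \<open>Reversal swaps the two diagonal entries of each block. The weight
  \<open>\<tau>\<^sup>2 = inverse \<omega>\<close> on even rows and its inverse \<omega> on odd rows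
  supply the factors created by the new coefficients.\<close>

lemma cmv_M2_reflect:
  assumes "odd N" "cmod \<omega> = 1" "\<tau>\<^sup>2 = inverse \<omega>"
  shows "cmv_M2 N (\<lambda>n. - \<omega> * cnj (a (N - n - 1))) =
    quasi_reflection N \<tau> * cmv_M2 N a * quasi_reflection N (inverse \<tau>)"
proof -
  have "\<omega> \<noteq> 0" using assms(2) by auto
  have \<tau>: "\<tau> * \<tau> = inverse \<omega>" using assms(3) by (simp add: power2_eq_square)
  then have \<tau>': "inverse \<tau> * inverse \<tau> = \<omega>"
    by (metis inverse_inverse_eq inverse_mult_distrib)
  have cnj: "cnj \<omega> = inverse \<omega>"
    using assms(2) by (metis inverse_unique complex_norm_square of_real_1 one_power2)
  have "\<tau> \<noteq> 0" using \<tau> \<open>\<omega> \<noteq> 0\<close> by auto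
  let ?b = "\<lambda>n. - \<omega> * cnj (a (N - n - 1))"
  let ?M = "quasi_reflection N \<tau> * cmv_M2 N a * quasi_reflection N (inverse \<tau>)"
  show ?thesis
  proof (rule eq_matI)
    fix k l
    assume "k < dim_row ?M" "l < dim_col ?M"
    then have kl: "k \<le> N" "l \<le> N" by (auto simp: quasi_reflection_def)
    have entry: "?M $$ (k, l) =
        (if even k then \<tau> else inverse \<tau>) * (if even l then \<tau> else inverse \<tau>) *
        cmv_M2 N a $$ (N - k, N - l)"
      using index_quasi_reflection_conj[OF \<open>odd N\<close> cmv_M2_carrier[OF \<open>odd N\<close>] kl, of "\<tau>"] by simp
    consider "k = l" | "k \<noteq> l" "k div 2 = l div 2" | "k div 2 \<noteq> l div 2" by blast
    then show "cmv_M2 N ?b $$ (k, l) = ?M $$ (k, l)"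
    proof cases
      case 1
      show ?thesis
        unfolding entry index_cmv_M2[OF \<open>odd N\<close> kl] index_cmv_M2[OF \<open>odd N\<close> diff_le_self diff_le_self]
        using kl \<open>odd N\<close> 1
        by (cases "even k") (simp_all add: cnj \<tau> \<tau>' \<open>\<omega> \<noteq> 0\<close>)
    next
      case 2
      \<comment> \<open>Opposite parities make the two weights cancel, and \<open>cmv_rho\<close>
        depends only on the modulus, which \<omega> preserves.\<close>
      have "even k \<longleftrightarrow> odd l"
        using 2 by presburger
      moreover have "(N - k) div 2 = (N - l) div 2"
        using 2 unfolding odd_diff_div_2_eq_iff[OF \<open>odd N\<close> kl] by simp
      moreover have "N - k \<noteq> N - l" using 2 kl by auto
      ultimately show ?thesis
        unfolding entry index_cmv_M2[OF \<open>odd N\<close> kl] index_cmv_M2[OF \<open>odd N\<close> diff_le_self diff_le_self]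
          odd_diff_double_div_2[OF \<open>odd N\<close> kl, symmetric]
        using 2 \<open>\<tau> \<noteq> 0\<close> cmv_rho_reflect[OF assms(2)]
        by simp
    next
      case 3
      then have "(N - k) div 2 \<noteq> (N - l) div 2"
        unfolding odd_diff_div_2_eq_iff[OF \<open>odd N\<close> kl] .
      moreover have "k \<noteq> l" "N - k \<noteq> N - l" using 3 kl by auto
      ultimately show ?thesis
        unfolding entry index_cmv_M2[OF \<open>odd N\<close> kl] index_cmv_M2[OF \<open>odd N\<close> diff_le_self diff_le_self]
        using 3 by simp
    qed
  qed (auto simp: quasi_reflection_def carrier_matD[OF cmv_M2_carrier[OF \<open>odd N\<close>]])
qed

text \<open>Blocks now start at odd rows, so \<tau> and its inverse trade places. The same weights
  repair the swapped corners: \<omega> times \<open>inverse \<omega>\<close> gives 1 at row 0, and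
  \<open>inverse \<omega>\<close> times 1 appears at row \<open>N\<close>.\<close>

lemma cmv_M1_reflect:
  assumes "odd N" "cmod \<omega> = 1" "\<tau>\<^sup>2 = inverse \<omega>"
  shows "cmv_M1 N (\<lambda>n. - \<omega> * cnj (a (N - n - 1))) \<omega> =
    quasi_reflection N (inverse \<tau>) * cmv_M1 N a \<omega> * quasi_reflection N \<tau>"
proof -
  have "\<omega> \<noteq> 0" using assms(2) by auto
  have \<tau>: "\<tau> * \<tau> = inverse \<omega>" using assms(3) by (simp add: power2_eq_square)
  then have \<tau>': "inverse \<tau> * inverse \<tau> = \<omega>"
    by (metis inverse_inverse_eq inverse_mult_distrib)
  have cnj: "cnj \<omega> = inverse \<omega>"
    using assms(2) by (metis inverse_unique complex_norm_square of_real_1 one_power2)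
  have "\<tau> \<noteq> 0" using \<tau> \<open>\<omega> \<noteq> 0\<close> by auto
  let ?b = "\<lambda>n. - \<omega> * cnj (a (N - n - 1))"
  let ?M = "quasi_reflection N (inverse \<tau>) * cmv_M1 N a \<omega> * quasi_reflection N \<tau>"
  show ?thesis
  proof (rule eq_matI)
    fix k l
    assume "k < dim_row ?M" "l < dim_col ?M"
    then have kl: "k \<le> N" "l \<le> N" by (auto simp: quasi_reflection_def)
    have entry: "?M $$ (k, l) =
        (if even k then inverse \<tau> else \<tau>) * (if even l then inverse \<tau> else \<tau>) *
        cmv_M1 N a \<omega> $$ (N - k, N - l)"
      using index_quasi_reflection_conj[OF \<open>odd N\<close> cmv_M1_carrier[OF \<open>odd N\<close>] kl, of "inverse \<tau>"] by simp
    consider "k = l" | "k \<noteq> l" "(k + 1) div 2 = (l + 1) div 2" | "(k + 1) div 2 \<noteq> (l + 1) div 2" by blast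
    then show "cmv_M1 N ?b \<omega> $$ (k, l) = ?M $$ (k, l)"
    proof cases
      case 1
      \<comment> \<open>Identifies when the reflected index hits the right corner; \<open>N\<close>
        is positive, being odd.\<close>
      have ends: "N - l = N \<longleftrightarrow> l = 0" using kl \<open>odd N\<close> by auto
      show ?thesis
        unfolding entry index_cmv_M1[OF \<open>odd N\<close> kl] index_cmv_M1[OF \<open>odd N\<close> diff_le_self diff_le_self]
        using kl \<open>odd N\<close> 1
        by (cases "k = 0"; cases "k = N"; cases "even k") (simp_all add: cnj \<tau> \<tau>' \<open>\<omega> \<noteq> 0\<close> ends)
    next
      case 2
      \<comment> \<open>Each corner is alone in its class, so two distinct indices in one class are
        interior.\<close>
      have "0 < k" "k < N"
        using 2 kl \<open>odd N\<close> by presburger+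
      have "even k \<longleftrightarrow> odd l"
        using 2 by presburger
      moreover have "(N - k + 1) div 2 = (N - l + 1) div 2"
        using 2 unfolding odd_diff_Suc_div_2_eq_iff[OF \<open>odd N\<close> kl] by simp
      moreover have "N - k \<noteq> N - l" using 2 kl by auto
      ultimately show ?thesis
        unfolding entry index_cmv_M1[OF \<open>odd N\<close> kl] index_cmv_M1[OF \<open>odd N\<close> diff_le_self diff_le_self]
          odd_diff_double_Suc_div_2[OF \<open>odd N\<close> kl \<open>0 < k\<close> \<open>k < N\<close>, symmetric]
        using 2 \<open>\<tau> \<noteq> 0\<close> cmv_rho_reflect[OF assms(2)]
        by simp
    next
      case 3
      then have "(N - k + 1) div 2 \<noteq> (N - l + 1) div 2"
        unfolding odd_diff_Suc_div_2_eq_iff[OF \<open>odd N\<close> kl] .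
      moreover have "k \<noteq> l" "N - k \<noteq> N - l" using 3 kl by auto
      ultimately show ?thesis
        unfolding entry index_cmv_M1[OF \<open>odd N\<close> kl] index_cmv_M1[OF \<open>odd N\<close> diff_le_self diff_le_self]
        using 3 by simp
    qed
  qed (auto simp: quasi_reflection_def carrier_matD[OF cmv_M1_carrier[OF \<open>odd N\<close>]])
qed

section \<open>Cancellation of the inner quasi-reflections\<close>

theorem proposition7p4:
  fixes N :: nat and \<omega> \<tau> :: complex and a :: "nat \<Rightarrow> complex"
  assumes "N \<ge> 1" and "odd N"
    and "cmod \<omega> = 1"
    and "\<And>n. n < N \<Longrightarrow> cmod (a n) < 1"
    and "\<tau>\<^sup>2 = inverse \<omega>"
  shows "cmv_matrix N (\<lambda>n. - \<omega> * cnj (a (N - n - 1))) \<omega>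
       = quasi_reflection N \<tau> * cmv_matrix N a \<omega> * quasi_reflection N \<tau>"
proof -
  let ?Q = "quasi_reflection N \<tau>" and ?R = "quasi_reflection N (inverse \<tau>)"
  let ?A = "cmv_M2 N a" and ?B = "cmv_M1 N a \<omega>"
  have A: "?A \<in> carrier_mat (N + 1) (N + 1)" and B: "?B \<in> carrier_mat (N + 1) (N + 1)"
    using \<open>odd N\<close> by (rule cmv_M2_carrier cmv_M1_carrier)+
  have Q: "?Q \<in> carrier_mat (N + 1) (N + 1)" and R: "?R \<in> carrier_mat (N + 1) (N + 1)"
    by (rule quasi_reflection_carrier)+
  have "\<tau> \<noteq> 0" using assms(3,5) by auto
  \<comment> \<open>The left side is the product of the reflected factors; reassociation makes the
    two copies of \<open>?R\<close> adjacent.\<close>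
  have "?Q * ?A * ?R * (?R * ?B * ?Q) = ?Q * ?A * (?R * ?R) * (?B * ?Q)"
    using A B Q R by (simp add: assoc_mult_mat[of _ "N+1" "N+1" _ "N+1" _ "N+1"]
        mult_carrier_mat[of _ "N+1" "N+1" _ "N+1"])
  also have "\<dots> = ?Q * ?A * (?B * ?Q)"
    using A Q \<open>\<tau> \<noteq> 0\<close> by (simp add: quasi_reflection_square[OF \<open>odd N\<close>]
        right_mult_one_mat[OF mult_carrier_mat])
  also have "\<dots> = ?Q * (?A * ?B) * ?Q"
    using A B Q R by (simp add: assoc_mult_mat[of _ "N+1" "N+1" _ "N+1" _ "N+1"]
        mult_carrier_mat[of _ "N+1" "N+1" _ "N+1"])
  finally show ?thesis
    unfolding cmv_matrix_def cmv_M2_reflect[OF assms(2,3,5)] cmv_M1_reflect[OF assms(2,3,5)] .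
qed

end
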